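(* Fix $\sigma>0$, $N\ge 1$ and $\beta>0$. Assume that the noise distribution $\Psi$ has mean $0$ and finite, nonzero variance. Then, in dimension $d=1$, the optimally tuned worst-case risk of linear filtering over $\mathrm{PLIP}=\mathrm{PLIP}(\beta,N)$ satisfies $$\inf_{h>0}\mathcal{R}_n(L_h;\mathrm{PLIP})\asymp n^{-1/2},\qquad n\to\infty .$$
   Context: Model ($d=1$): let $\mathbb{I}_n=\{1,\dots,n\}$. One observes $Y_n(i)=f(i/n)+\sigma Z_n(i)$, $i\in\mathbb{I}_n$, where $f:[0,1]\to[0,1]$ is unknown, $\sigma>0$ is a fixed noise level and $(Z_n(i))_{i\in\mathbb{I}_n}$ is white noise, i.e. i.i.d. random variables with distribution $\Psi$. Linear filter: for $h>0$ let $\mathcal{W}[n,h](i)=\{j\in\mathbb{I}_n:|j-i|\le nh\}$ and $L_h[Y_n](i)=\mathrm{Average}\{Y_n(j):j\in\mathcal{W}[n,h](i)\}$. Risk: for an estimator $T$, $\mathcal{R}_n(T;f)=\frac1n\sum_{i\in\mathbb{I}_n}\mathbb{E}[(T[Y_n](i)-f(i/n))^2]$, and for a class $\mathcal{F}$ of functions, $\mathcal{R}_n(T;\mathcal{F})=\sup_{f\in\mathcal{F}}\mathcal{R}_n(T;f)$. Function class: the local Lipschitz constant of $f$ at $x$ is $\mathrm{Lip}_x(f)=\limsup_{\varepsilon\to0}\sup_{|y-x|\le\varepsilon,\,y\ne x}\frac{|f(y)-f(x)|}{|y-x|}$. $\mathrm{PLIP}(\beta,N)$ is the collection of functions $f:[0,1]\to[0,1]$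 having local Lipschitz constant bounded by $\beta$ at every point of the complement of some finite set $(x_i)_{i=1}^N\subset(0,1)$ (the set may depend on $f$). $a_n\asymp b_n$ means that the ratio $a_n/b_n$ is bounded away from $0$ and $\infty$ as $n$ becomes large (constants may depend on $\sigma,\beta,N,\Psi$). *)

theory Defs
  imports "HOL-Probability.Probability" "HOL-Library.Landau_Symbols"
begin

definition white_noise :: "'a measure \<Rightarrow> real measure \<Rightarrow> nat \<Rightarrow> (nat \<Rightarrow> 'a \<Rightarrow> real) \<Rightarrow> bool" where
  "white_noise M \<Psi> n Z \<longleftrightarrow>
     prob_space M \<and>
     prob_space.indep_vars M (\<lambda>_. borel) Z {1..n} \<and>
     (\<forall>i\<in>{1..n}. distr M borel (Z i) = \<Psi>)"

definition observation :: "real \<Rightarrow> nat \<Rightarrow> (nat \<Rightarrow> 'a \<Rightarrow> real) \<Rightarrow> (real \<Rightarrow> real) \<Rightarrow> 'a \<Rightarrow> nat \<Rightarrow> real" where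
  "observation \<sigma> n Z f \<omega> i = f (real i / real n) + \<sigma> * Z i \<omega>"

definition window :: "nat \<Rightarrow> real \<Rightarrow> nat \<Rightarrow> nat set" where
  "window n h i = {j \<in> {1..n}. \<bar>real j - real i\<bar> \<le> real n * h}"

definition linear_filter :: "nat \<Rightarrow> real \<Rightarrow> (nat \<Rightarrow> real) \<Rightarrow> nat \<Rightarrow> real" where
  "linear_filter n h y i = (\<Sum>j\<in>window n h i. y j) / real (card (window n h i))"

definition risk ::
  "'a measure \<Rightarrow> real \<Rightarrow> nat \<Rightarrow> (nat \<Rightarrow> 'a \<Rightarrow> real) \<Rightarrow> ((nat \<Rightarrow> real) \<Rightarrow> nat \<Rightarrow> real) \<Rightarrow> (real \<Rightarrow> real) \<Rightarrow> real" where
  "risk M \<sigma> n Z T f =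
     (1 / real n) * (\<Sum>i\<in>{1..n}. \<integral>\<omega>. (T (observation \<sigma> n Z f \<omega>) i - f (real i / real n))\<^sup>2 \<partial>M)"

text \<open>The supremum is taken in the reals. For a linear filter, square-integrable noise and functions
  with values in the unit interval, the risks are bounded uniformly in the function, so
  this is a genuine supremum.\<close>

definition worst_risk ::
  "'a measure \<Rightarrow> real \<Rightarrow> nat \<Rightarrow> (nat \<Rightarrow> 'a \<Rightarrow> real) \<Rightarrow> ((nat \<Rightarrow> real) \<Rightarrow> nat \<Rightarrow> real) \<Rightarrow> (real \<Rightarrow> real) set \<Rightarrow> real" where
  "worst_risk M \<sigma> n Z T F = (SUP f\<in>F. risk M \<sigma> n Z T f)"

text \<open>A function on the unit interval is a total function whose values elsewhere are irrelevant; the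
  difference quotients below therefore only involve points of the unit interval. The local
  Lipschitz constant may be infinite.\<close>

definition local_lip :: "(real \<Rightarrow> real) \<Rightarrow> real \<Rightarrow> ereal" where
  "local_lip f x =
     Limsup (at_right 0)
       (\<lambda>\<epsilon>. SUP y\<in>{y \<in> {0..1}. \<bar>y - x\<bar> \<le> \<epsilon> \<and> y \<noteq> x}. ereal (\<bar>f y - f x\<bar> / \<bar>y - x\<bar>))"

definition PLIP :: "real \<Rightarrow> nat \<Rightarrow> (real \<Rightarrow> real) set" where
  "PLIP \<beta> N =
     {f. f \<in> {0..1} \<rightarrow> {0..1} \<and>
         (\<exists>x :: nat \<Rightarrow> real. x ` {1..N} \<subseteq> {0<..<1} \<and>
            (\<forall>t \<in> {0..1} - x ` {1..N}. local_lip f t \<le> ereal \<beta>))}"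

end

theory Submission
  imports Defs
begin

text \<open>Pointwise, the mean squared error of a window average splits into squared bias and variance:
  averaging \<open>m\<close> uncorrelated noise terms leaves a variance proportional to \<open>1/m\<close>
  (\<open>risk_linear_filter\<close>). From there on the problem is deterministic. A window of width \<open>h\<close> contains
  about \<open>n h\<close> grid points, so the variance contributes order \<open>1/(n h)\<close> to the risk. Only windows
  that meet a jump can have a large bias, and these form a fraction of order \<open>h\<close> of all windows;
  the bias of the others is at most of order \<open>h\<close>, hence negligible after squaring. For bandwidths
  between \<open>1/n\<close> and 1 the worst risk is therefore of order \<open>h + 1/(n h)\<close>, and balancing the two terms at \<open>h = n powr (-1/2)\<close> gives the rate.

  For the upper bound this bandwidth is inserted (\<open>mse_bound_root_bandwidth\<close>). The bound on the
  windows without a jump rests on passing from pointwise local Lipschitz constants to a Lipschitz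
  estimate on an interval, which is a compactness argument (\<open>local_lip_imp_lipschitz\<close>).

  For the lower bound a single function, a unit step in the middle of the interval, is bad for
  every bandwidth: near the step a fixed proportion of each window lies on the wrong side, so a
  fraction of order \<open>h\<close> of the points has bias bounded away from zero. The inequality between the
  arithmetic and geometric means then bounds \<open>h + 1/(n h)\<close> from below whatever \<open>h\<close> is
  (\<open>mse_half_step_ge\<close>). One function suffices for all \<open>h\<close>, so no minimax argument is involved.\<close>

section \<open>Bias and variance of a linear filter\<close>

definition filter_bias :: "nat \<Rightarrow> real \<Rightarrow> (real \<Rightarrow> real) \<Rightarrow> nat \<Rightarrow> real" where
  "filter_bias n h f i = linear_filter n h (\<lambda>j. f (real j / real n)) i - f (real i / real n)"

lemma (in prob_space) indep_vars_expectation_mult: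
  fixes X :: "'i \<Rightarrow> 'a \<Rightarrow> real"
  assumes "indep_vars (\<lambda>_. borel) X I" and "\<And>i. i \<in> I \<Longrightarrow> integrable M (X i)"
    and "j \<in> I" and "k \<in> I" and "j \<noteq> k"
  shows "integrable M (\<lambda>\<omega>. X j \<omega> * X k \<omega>)"
    and "expectation (\<lambda>\<omega>. X j \<omega> * X k \<omega>) = expectation (X j) * expectation (X k)"
proof -
  have ind: "indep_vars (\<lambda>_. borel) X {j, k}"
    using assms by (intro indep_vars_subset[OF assms(1)]) auto
  show "integrable M (\<lambda>\<omega>. X j \<omega> * X k \<omega>)"
    using indep_vars_integrable[OF _ ind] assms by auto
  show "expectation (\<lambda>\<omega>. X j \<omega> * X k \<omega>) = expectation (X j) * expectation (X k)"
    using indep_vars_lebesgue_integral[OF _ ind] assms by auto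
qed

text \<open>Expanding the square leaves no term linear in the noise, because it is centred, and no mixed
  products, because it is independent; only the diagonal of the double sum survives.\<close>

lemma white_noise_expectation_square_affine:
  assumes noise: "white_noise M \<Psi> n Z"
    and int1: "integrable \<Psi> (\<lambda>x. x)" and mean: "(\<integral>x. x \<partial>\<Psi>) = 0"
    and int2: "integrable \<Psi> (\<lambda>x. x\<^sup>2)" and W: "W \<subseteq> {1..n}"
  shows "(\<integral>\<omega>. (b + c * (\<Sum>j\<in>W. Z j \<omega>))\<^sup>2 \<partial>M) = b\<^sup>2 + c\<^sup>2 * real (card W) * (\<integral>x. x\<^sup>2 \<partial>\<Psi>)"
proof -
  interpret prob_space M using noise by (simp add: white_noise_def)
  have ind: "indep_vars (\<lambda>_. borel) Z {1..n}"
    and distr: "\<And>i. i \<in> {1..n} \<Longrightarrow> distr M borel (Z i) = \<Psi>"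
    using noise by (auto simp: white_noise_def)
  have fin: "finite W" by (rule finite_subset[OF W]) simp
  have meas: "Z i \<in> borel_measurable M" if "i \<in> {1..n}" for i
    using ind that unfolding indep_vars_def by blast
  have Zint: "integrable M (Z i)" and Zmean: "expectation (Z i) = 0"
    and Zint2: "integrable M (\<lambda>\<omega>. Z i \<omega> * Z i \<omega>)"
    and Zvar: "expectation (\<lambda>\<omega>. Z i \<omega> * Z i \<omega>) = (\<integral>x. x\<^sup>2 \<partial>\<Psi>)"
    if i: "i \<in> {1..n}" for i
  proof -
    note m = meas[OF i]
    show "integrable M (Z i)"
      by (rule integrable_distr[OF m, of "\<lambda>x. x", unfolded distr[OF i], OF int1])
    show "integrable M (\<lambda>\<omega>. Z i \<omega> * Z i \<omega>)"
      using integrable_distr[OF m, of "\<lambda>x. x\<^sup>2", unfolded distr[OF i], OF int2]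
      by (simp only: power2_eq_square)
    show "expectation (Z i) = 0"
      using integral_distr[OF m, of "\<lambda>x. x", unfolded distr[OF i]] mean
      by simp
    show "expectation (\<lambda>\<omega>. Z i \<omega> * Z i \<omega>) = (\<integral>x. x\<^sup>2 \<partial>\<Psi>)"
      using integral_distr[OF m, of "\<lambda>x. x\<^sup>2", unfolded distr[OF i]]
      by (simp add: power2_eq_square)
  qed
  let ?v = "\<integral>x. x\<^sup>2 \<partial>\<Psi>"
  have prod: "integrable M (\<lambda>\<omega>. Z j \<omega> * Z k \<omega>)"
    "expectation (\<lambda>\<omega>. Z j \<omega> * Z k \<omega>) = (if k = j then ?v else 0)"
    if "j \<in> W" "k \<in> W" for j k
  proof -
    have jk: "j \<in> {1..n}" "k \<in> {1..n}" using that W by auto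
    show "integrable M (\<lambda>\<omega>. Z j \<omega> * Z k \<omega>)"
      using indep_vars_expectation_mult(1)[OF ind Zint jk] Zint2[OF jk(1)] by (cases "j = k") auto
    show "expectation (\<lambda>\<omega>. Z j \<omega> * Z k \<omega>) = (if k = j then ?v else 0)"
      using indep_vars_expectation_mult(2)[OF ind Zint jk] Zvar[OF jk(1)] Zmean jk
      by (cases "j = k") auto
  qed
  have Wint: "integrable M (Z j)" "expectation (Z j) = 0" if "j \<in> W" for j
    using Zint Zmean W that by auto
  have "(\<integral>\<omega>. (b + c * (\<Sum>j\<in>W. Z j \<omega>))\<^sup>2 \<partial>M)
      = (\<integral>\<omega>. b\<^sup>2 + (2 * b * c * (\<Sum>j\<in>W. Z j \<omega>) + c\<^sup>2 * (\<Sum>j\<in>W. \<Sum>k\<in>W. Z j \<omega> * Z k \<omega>)) \<partial>M)"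
    by (intro Bochner_Integration.integral_cong refl)
      (simp add: power2_eq_square algebra_simps sum_product)
  also have "\<dots> = b\<^sup>2 + (2 * b * c * (\<Sum>j\<in>W. expectation (Z j))
      + c\<^sup>2 * (\<Sum>j\<in>W. \<Sum>k\<in>W. expectation (\<lambda>\<omega>. Z j \<omega> * Z k \<omega>)))"
    using Wint prod(1) by (simp add: prob_space)
  also have "\<dots> = b\<^sup>2 + c\<^sup>2 * real (card W) * ?v"
    using Wint prod(2) fin by (simp add: sum.delta')
  finally show ?thesis .
qed

lemma window_subset: "window n h i \<subseteq> {1..n}"
  by (auto simp: window_def)

lemma finite_window [simp]: "finite (window n h i)"
  by (rule finite_subset[OF window_subset]) simp

lemma self_in_window: "h \<ge> 0 \<Longrightarrow> i \<in> {1..n} \<Longrightarrow> i \<in> window n h i"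
  by (simp add: window_def)

lemma card_window_pos: "h \<ge> 0 \<Longrightarrow> i \<in> {1..n} \<Longrightarrow> card (window n h i) > 0"
  using self_in_window[of h i n] by (auto simp: card_gt_0_iff)

text \<open>This removes the probability space: the right-hand side is a deterministic function of the
  signal and the window sizes.\<close>

lemma risk_linear_filter:
  assumes noise: "white_noise M \<Psi> n Z"
    and "integrable \<Psi> (\<lambda>x. x)" and "(\<integral>x. x \<partial>\<Psi>) = 0" and "integrable \<Psi> (\<lambda>x. x\<^sup>2)"
    and "h \<ge> 0"
  shows "risk M \<sigma> n Z (linear_filter n h) f =
    (\<Sum>i\<in>{1..n}. (filter_bias n h f i)\<^sup>2
        + \<sigma>\<^sup>2 * (\<integral>x. x\<^sup>2 \<partial>\<Psi>) / real (card (window n h i))) / real n"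
proof -
  let ?v = "\<integral>x. x\<^sup>2 \<partial>\<Psi>"
  have "(\<integral>\<omega>. (linear_filter n h (observation \<sigma> n Z f \<omega>) i - f (real i / real n))\<^sup>2 \<partial>M)
      = (filter_bias n h f i)\<^sup>2 + \<sigma>\<^sup>2 * ?v / real (card (window n h i))"
    if i: "i \<in> {1..n}" for i
  proof -
    let ?W = "window n h i"
    let ?m = "real (card ?W)"
    have m: "?m > 0" using card_window_pos[OF \<open>h \<ge> 0\<close> i] by simp
    have "linear_filter n h (observation \<sigma> n Z f \<omega>) i - f (real i / real n)
        = filter_bias n h f i + \<sigma> / ?m * (\<Sum>j\<in>?W. Z j \<omega>)" for \<omega>
      by (simp add: linear_filter_def filter_bias_def observation_def sum.distrib
          sum_distrib_left[symmetric] add_divide_distrib)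
    then have "(\<integral>\<omega>. (linear_filter n h (observation \<sigma> n Z f \<omega>) i - f (real i / real n))\<^sup>2 \<partial>M)
        = (filter_bias n h f i)\<^sup>2 + (\<sigma> / ?m)\<^sup>2 * ?m * ?v"
      by (simp only: white_noise_expectation_square_affine[OF assms(1-4) window_subset])
    also have "(\<sigma> / ?m)\<^sup>2 * ?m * ?v = \<sigma>\<^sup>2 * ?v / ?m"
      using m by (simp add: field_simps power2_eq_square)
    finally show ?thesis .
  qed
  then show ?thesis by (simp add: risk_def)
qed

lemma abs_filter_bias_le:
  assumes "h \<ge> 0" and i: "i \<in> {1..n}"
    and close: "\<And>j. j \<in> window n h i \<Longrightarrow> \<bar>f (real j / real n) - f (real i / real n)\<bar> \<le> c"
  shows "\<bar>filter_bias n h f i\<bar> \<le> c"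
proof -
  let ?W = "window n h i"
  let ?m = "real (card ?W)"
  have m: "?m > 0" using card_window_pos[OF assms(1,2)] by simp
  have "filter_bias n h f i = (\<Sum>j\<in>?W. f (real j / real n) - f (real i / real n)) / ?m"
    using m card_gt_0_iff[of ?W]
    by (simp add: filter_bias_def linear_filter_def sum_subtractf diff_divide_distrib)
  also have "\<bar>\<dots>\<bar> \<le> (\<Sum>j\<in>?W. \<bar>f (real j / real n) - f (real i / real n)\<bar>) / ?m"
    using m by (simp add: divide_right_mono abs_divide)
  also have "\<dots> \<le> (?m * c) / ?m"
    using sum_bounded_above[of ?W, OF close] m by (intro divide_right_mono) auto
  also have "\<dots> = c" using m by (metis nonzero_mult_div_cancel_left less_irrefl)
  finally show ?thesis .
qed

lemma PLIP_diff_le_1: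
  assumes "f \<in> PLIP \<beta> N" and "x \<in> {0..1}" and "y \<in> {0..1}"
  shows "\<bar>f x - f y\<bar> \<le> 1"
proof -
  have "f x \<in> {0..1}" "f y \<in> {0..1}" using assms by (auto simp: PLIP_def)
  then show ?thesis by auto
qed

lemma abs_filter_bias_PLIP_le_1:
  assumes "f \<in> PLIP \<beta> N" and "h \<ge> 0" and i: "i \<in> {1..n}"
  shows "\<bar>filter_bias n h f i\<bar> \<le> 1"
proof (rule abs_filter_bias_le[OF \<open>h \<ge> 0\<close> i])
  have grid: "real j / real n \<in> {0..1}" if "j \<in> {1..n}" for j
    using that by (simp add: divide_le_eq)
  fix j assume "j \<in> window n h i"
  then have "j \<in> {1..n}" by (simp add: window_def)
  then show "\<bar>f (real j / real n) - f (real i / real n)\<bar> \<le> 1"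
    using PLIP_diff_le_1[OF \<open>f \<in> PLIP \<beta> N\<close> grid grid] i by simp
qed

section \<open>Lipschitz bounds between jumps\<close>

text \<open>Any \<open>\<gamma>\<close> strictly above the limit superior is eventually an upper bound for the difference
  quotients. At \<open>\<gamma> = \<beta>\<close> this may fail, since the quotients can approach their
  limit superior from above.\<close>

lemma local_lip_eventually:
  assumes "local_lip f t \<le> ereal \<beta>" and "\<beta> < \<gamma>"
  obtains d where "d > 0"
    and "\<And>y. y \<in> {0..1} \<Longrightarrow> \<bar>y - t\<bar> \<le> d \<Longrightarrow> \<bar>f y - f t\<bar> \<le> \<gamma> * \<bar>y - t\<bar>"
proof -
  have "local_lip f t < ereal \<gamma>"
    using assms by (meson ereal_less_eq(3) less_ereal.simps(1) order_le_less_trans)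
  then have "eventually (\<lambda>\<epsilon>. (SUP y\<in>{y \<in> {0..1}. \<bar>y - t\<bar> \<le> \<epsilon> \<and> y \<noteq> t}.
      ereal (\<bar>f y - f t\<bar> / \<bar>y - t\<bar>)) < ereal \<gamma>) (at_right 0)"
    unfolding local_lip_def by (rule Limsup_lessD)
  then obtain b :: real where "b > 0" and
    b: "\<And>\<epsilon>. 0 < \<epsilon> \<Longrightarrow> \<epsilon> < b \<Longrightarrow> (SUP y\<in>{y \<in> {0..1}. \<bar>y - t\<bar> \<le> \<epsilon> \<and> y \<noteq> t}.
      ereal (\<bar>f y - f t\<bar> / \<bar>y - t\<bar>)) < ereal \<gamma>"
    unfolding eventually_at_right_field by blast
  have "\<bar>f y - f t\<bar> \<le> \<gamma> * \<bar>y - t\<bar>" if "y \<in> {0..1}" "\<bar>y - t\<bar> \<le> b / 2" for y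
  proof (cases "y = t")
    case False
    have "ereal (\<bar>f y - f t\<bar> / \<bar>y - t\<bar>) \<le> (SUP y\<in>{y \<in> {0..1}. \<bar>y - t\<bar> \<le> b / 2 \<and> y \<noteq> t}.
        ereal (\<bar>f y - f t\<bar> / \<bar>y - t\<bar>))"
      using that False by (intro SUP_upper) auto
    also have "\<dots> < ereal \<gamma>" using b[of "b / 2"] \<open>b > 0\<close> by simp
    finally show ?thesis using False by (simp add: field_simps)
  qed simp
  then show thesis using that[of "b / 2"] \<open>b > 0\<close> by simp
qed

text \<open>The estimate \<open>\<bar>f v - f u\<bar> \<le> \<gamma> (v - u)\<close> is transitive in the endpoints, by the triangle
  inequality, and holds for all sufficiently short intervals around any given point. Repeated
  bisection of the interval therefore propagates it to the endpoints.\<close>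

lemma local_lip_imp_lipschitz:
  assumes "a \<le> b" and "{a..b} \<subseteq> {0..1}"
    and lip: "\<And>t. t \<in> {a..b} \<Longrightarrow> local_lip f t \<le> ereal \<beta>" and "\<beta> < \<gamma>"
  shows "\<bar>f b - f a\<bar> \<le> \<gamma> * (b - a)"
proof -
  \<comment> \<open>The bisection principle quantifies over all short intervals around a point, including those
    that leave the given interval; the premise confines the claim to subintervals.\<close>
  have "a \<le> a \<and> b \<le> b \<longrightarrow> \<bar>f b - f a\<bar> \<le> \<gamma> * (b - a)"
    using \<open>a \<le> b\<close>
  proof (induction rule: Bolzano[where P = "\<lambda>u v. a \<le> u \<and> v \<le> b \<longrightarrow> \<bar>f v - f u\<bar> \<le> \<gamma> * (v - u)"])
    case (trans u v w)
    show ?case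
    proof
      assume "a \<le> u \<and> w \<le> b"
      then have "\<bar>f v - f u\<bar> \<le> \<gamma> * (v - u)" "\<bar>f w - f v\<bar> \<le> \<gamma> * (w - v)" using trans by auto
      then show "\<bar>f w - f u\<bar> \<le> \<gamma> * (w - u)" by (simp add: algebra_simps)
    qed
  next
    case (local x)
    then obtain d where "d > 0" and
      d: "\<And>y. y \<in> {0..1} \<Longrightarrow> \<bar>y - x\<bar> \<le> d \<Longrightarrow> \<bar>f y - f x\<bar> \<le> \<gamma> * \<bar>y - x\<bar>"
      using local_lip_eventually[OF lip[of x] \<open>\<beta> < \<gamma>\<close>] by auto
    have "\<bar>f v - f u\<bar> \<le> \<gamma> * (v - u)"
      if "u \<le> x" "x \<le> v" "v - u < d" "a \<le> u" "v \<le> b" for u v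
    proof -
      have "u \<in> {a..b}" "v \<in> {a..b}" using that by auto
      then have "u \<in> {0..1}" "v \<in> {0..1}" using assms(2) by blast+
      then have "\<bar>f v - f x\<bar> \<le> \<gamma> * (v - x)" "\<bar>f u - f x\<bar> \<le> \<gamma> * (x - u)"
        using d[of u] d[of v] that by auto
      then show ?thesis by (simp add: algebra_simps)
    qed
    then show ?case using \<open>d > 0\<close> by blast
  qed
  then show ?thesis by simp
qed

section \<open>Counting grid points\<close>

lemma card_nat_near_le:
  assumes "a \<ge> 0"
  shows "finite {j::nat. \<bar>real j - c\<bar> \<le> a}" and "real (card {j::nat. \<bar>real j - c\<bar> \<le> a}) \<le> 2 * a + 1"
proof -
  let ?S = "{j::nat. \<bar>real j - c\<bar> \<le> a}" and ?I = "{\<lceil>c - a\<rceil>..\<lfloor>c + a\<rfloor>}"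
  have sub: "int ` ?S \<subseteq> ?I" by (auto simp: ceiling_le_iff le_floor_iff abs_le_iff)
  show fin: "finite ?S"
    using finite_subset[OF sub] by (simp add: finite_image_iff)
  have "card ?S = card (int ` ?S)" by (simp add: card_image)
  also have "\<dots> \<le> card ?I" using sub by (intro card_mono) auto
  finally have "real (card ?S) \<le> real (nat (\<lfloor>c + a\<rfloor> - \<lceil>c - a\<rceil> + 1))" by simp
  also have "\<dots> \<le> 2 * a + 1"
  proof -
    have "real_of_int (\<lfloor>c + a\<rfloor> - \<lceil>c - a\<rceil> + 1) \<le> 2 * a + 1" by linarith
    then show ?thesis using assms by (simp add: of_nat_nat) 
  qed
  finally show "real (card ?S) \<le> 2 * a + 1" .
qed

text \<open>Only the integer part of the bandwidth matters. Truncated subtraction on the left end is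
  harmless because the window is cut off at the boundary anyway.\<close>

lemma window_eq_nat:
  assumes "h \<ge> 0"
  shows "window n h i = {1..n} \<inter> {i - nat \<lfloor>real n * h\<rfloor>..i + nat \<lfloor>real n * h\<rfloor>}"
proof -
  have "\<bar>real j - real i\<bar> \<le> real n * h \<longleftrightarrow> i - nat \<lfloor>real n * h\<rfloor> \<le> j \<and> j \<le> i + nat \<lfloor>real n * h\<rfloor>" for j
  proof -
    have "\<bar>real j - real i\<bar> \<le> real n * h \<longleftrightarrow> real_of_int \<bar>int j - int i\<bar> \<le> real n * h" by simp
    also have "\<dots> \<longleftrightarrow> \<bar>int j - int i\<bar> \<le> \<lfloor>real n * h\<rfloor>" by (rule le_floor_iff[symmetric])
    also have "\<dots> \<longleftrightarrow> i - nat \<lfloor>real n * h\<rfloor> \<le> j \<and> j \<le> i + nat \<lfloor>real n * h\<rfloor>"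
    proof -
      have "\<lfloor>real n * h\<rfloor> \<ge> 0" using assms by simp
      then obtain k where "\<lfloor>real n * h\<rfloor> = int k" by (rule nonneg_int_cases)
      then show ?thesis by auto
    qed
    finally show ?thesis .
  qed
  then show ?thesis by (simp only: window_def set_eq_iff mem_Collect_eq Int_iff atLeastAtMost_iff) blast
qed

lemma card_window_le:
  assumes "h \<ge> 0"
  shows "card (window n h i) \<le> 2 * min (nat \<lfloor>real n * h\<rfloor>) n + 1"
proof -
  let ?k = "nat \<lfloor>real n * h\<rfloor>"
  have "card (window n h i) \<le> card {i - ?k..i + ?k}"
    unfolding window_eq_nat[OF assms] by (intro card_mono) auto
  moreover have "card (window n h i) \<le> n"
    using card_mono[OF _ window_subset[of n h i]] by simp
  ultimately show ?thesis by auto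
qed

text \<open>At least one half of a window survives the truncation at the boundary: on the side of the
  larger part of the grid there is room for half of the bandwidth.\<close>

lemma card_window_ge:
  assumes "h \<ge> 0" and "h \<le> 1" and i: "i \<in> {1..n}"
  shows "real n * h / 2 \<le> real (card (window n h i))"
proof -
  define k where "k = nat \<lfloor>real n * h\<rfloor>"
  have h: "real n * h \<le> real n" using assms mult_left_le[of h "real n"] by simp
  have k: "k \<le> n" "real n * h < real k + 1" using assms h unfolding k_def by linarith+
  have "k + 1 \<le> 2 * card (window n h i)"
  proof (cases "2 * i \<le> n + 1")
    case True
    have "card {i..min (i + k) n} \<le> card (window n h i)"
      using i unfolding window_eq_nat[OF \<open>h \<ge> 0\<close>] k_def by (intro card_mono) auto
    then show ?thesis using True k i by auto
  next
    case False
    have "card {max (i - k) 1..i} \<le> card (window n h i)"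
      using i unfolding window_eq_nat[OF \<open>h \<ge> 0\<close>] k_def by (intro card_mono) auto
    then show ?thesis using False k i by (auto simp: max_def split: if_splits)
  qed
  then show ?thesis using k by linarith
qed

section \<open>The upper bound\<close>

lemma filter_bias_le_away_from_jumps:
  assumes f: "\<forall>t\<in>{0..1} - X. local_lip f t \<le> ereal \<beta>" and "\<beta> < \<gamma>" "0 \<le> \<gamma>"
    and "h \<ge> 0" and i: "i \<in> {1..n}"
    and away: "\<And>x. x \<in> X \<Longrightarrow> real n * h < \<bar>real i - real n * x\<bar>"
  shows "\<bar>filter_bias n h f i\<bar> \<le> \<gamma> * h"
proof (rule abs_filter_bias_le[OF \<open>h \<ge> 0\<close> i])
  fix j assume "j \<in> window n h i"
  then have j: "j \<in> {1..n}" "\<bar>real j - real i\<bar> \<le> real n * h" by (auto simp: window_def)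
  have n: "real n > 0" using i by simp
  define u where "u = min (real i / real n) (real j / real n)"
  define w where "w = max (real i / real n) (real j / real n)"
  have uw: "u \<le> w" "0 \<le> u" "w \<le> 1" "w - u \<le> h"
    using i j n by (auto simp: u_def w_def min_def max_def field_simps)
  have "t \<notin> X" if t: "t \<in> {u..w}" for t
  proof
    assume "t \<in> X"
    have "real n * u \<le> real n * t" "real n * t \<le> real n * w" using t n by auto
    moreover have "real n * u = min (real i) (real j)" "real n * w = max (real i) (real j)"
      using n by (auto simp: u_def w_def min_def max_def field_simps)
    ultimately show False using away[OF \<open>t \<in> X\<close>] j by linarith
  qed
  then have "\<bar>f w - f u\<bar> \<le> \<gamma> * (w - u)"
    using uw f \<open>\<beta> < \<gamma>\<close> by (intro local_lip_imp_lipschitz) auto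
  also have "\<dots> \<le> \<gamma> * h" using uw \<open>0 \<le> \<gamma>\<close> by (intro mult_left_mono)
  finally show "\<bar>f (real j / real n) - f (real i / real n)\<bar> \<le> \<gamma> * h"
    by (auto simp: u_def w_def min_def max_def split: if_splits)
qed

text \<open>Each jump spoils only the grid points within one bandwidth of it, and there the squared bias is
  at most one because the signal takes values in the unit interval. Everywhere else the Lipschitz
  estimate applies.\<close>

lemma sum_filter_bias_square_le:
  assumes f: "f \<in> PLIP \<beta> N" and "\<beta> < \<gamma>" "0 \<le> \<gamma>" and "h \<ge> 0"
  shows "(\<Sum>i\<in>{1..n}. (filter_bias n h f i)\<^sup>2) \<le> real N * (2 * (real n * h) + 1) + real n * (\<gamma> * h)\<^sup>2"
proof -
  obtain x :: "nat \<Rightarrow> real" where lip: "\<forall>t\<in>{0..1} - x ` {1..N}. local_lip f t \<le> ereal \<beta>"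
    using f by (auto simp: PLIP_def)
  \<comment> \<open>the grid points whose window may contain a jump\<close>
  define B where "B = {1..n} \<inter> (\<Union>l\<in>{1..N}. {i::nat. \<bar>real i - real n * x l\<bar> \<le> real n * h})"
  have nh: "real n * h \<ge> 0" using \<open>h \<ge> 0\<close> by simp
  have "card B \<le> card (\<Union>l\<in>{1..N}. {i::nat. \<bar>real i - real n * x l\<bar> \<le> real n * h})"
    unfolding B_def using card_nat_near_le(1)[OF nh] by (intro card_mono) auto
  also have "\<dots> \<le> (\<Sum>l\<in>{1..N}. card {i::nat. \<bar>real i - real n * x l\<bar> \<le> real n * h})"
    by (rule card_UN_le) simp
  finally have "real (card B) \<le> real (\<Sum>l\<in>{1..N}. card {i::nat. \<bar>real i - real n * x l\<bar> \<le> real n * h})"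
    by (rule of_nat_mono)
  also have "\<dots> \<le> real N * (2 * (real n * h) + 1)"
    using sum_bounded_above[of "{1..N}", OF card_nat_near_le(2)[OF nh]] by simp
  finally have B: "real (card B) \<le> real N * (2 * (real n * h) + 1)" .
  have "(filter_bias n h f i)\<^sup>2 \<le> (if i \<in> B then 1 else 0) + (\<gamma> * h)\<^sup>2" if i: "i \<in> {1..n}" for i
  proof (cases "i \<in> B")
    case True
    have "(filter_bias n h f i)\<^sup>2 \<le> 1"
      using abs_filter_bias_PLIP_le_1[OF f \<open>h \<ge> 0\<close> i] by (simp add: abs_square_le_1)
    then show ?thesis using True by (simp add: add_increasing2)
  next
    case False
    then have "\<bar>filter_bias n h f i\<bar> \<le> \<gamma> * h"
      using i by (intro filter_bias_le_away_from_jumps[OF lip assms(2-4)]) (force simp: B_def)+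
    then show ?thesis using False power_mono[of "\<bar>filter_bias n h f i\<bar>" _ 2] by simp
  qed
  then have "(\<Sum>i\<in>{1..n}. (filter_bias n h f i)\<^sup>2) \<le> (\<Sum>i\<in>{1..n}. (if i \<in> B then 1 else 0) + (\<gamma> * h)\<^sup>2)"
    by (intro sum_mono)
  also have "\<dots> = real (card B) + real n * (\<gamma> * h)\<^sup>2"
  proof -
    have "{1..n} \<inter> B = B" by (auto simp: B_def)
    then show ?thesis by (simp add: sum.distrib sum.If_cases)
  qed
  finally show ?thesis using B by linarith
qed

text \<open>The number \<open>v\<close> stands for the variance of a single observation. The factor two in front of
  \<open>\<beta>\<close> is the slack that the local Lipschitz condition requires; its size is immaterial.\<close>

lemma mse_bound_root_bandwidth:
  assumes f: "f \<in> PLIP \<beta> N" and "\<beta> > 0" and "v \<ge> 0" and "n \<ge> 1" and h: "h = 1 / sqrt (real n)"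
  shows "(\<Sum>i\<in>{1..n}. (filter_bias n h f i)\<^sup>2 + v / real (card (window n h i))) / real n
    \<le> (3 * real N + (2 * \<beta>)\<^sup>2 + 2 * v) / sqrt (real n)"
proof -
  define s where "s = sqrt (real n)"
  have s: "s \<ge> 1" "real n = s * s" using \<open>n \<ge> 1\<close> by (auto simp: s_def)
  have h': "h = 1 / s" "0 \<le> h" "h \<le> 1" "real n * h = s" using s h by (auto simp: s_def[symmetric])
  have "v / real (card (window n h i)) \<le> v / (s / 2)" if "i \<in> {1..n}" for i
    using card_window_ge[OF h'(2,3) that] card_window_pos[OF h'(2) that] h' s \<open>v \<ge> 0\<close>
    by (intro divide_left_mono) auto
  then have "(\<Sum>i\<in>{1..n}. v / real (card (window n h i))) \<le> (\<Sum>i\<in>{1..n}. v / (s / 2))"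
    by (intro sum_mono)
  also have "\<dots> = 2 * v * s" using s by simp
  finally have var: "(\<Sum>i\<in>{1..n}. v / real (card (window n h i))) \<le> 2 * v * s" .
  have sq_bias: "(\<Sum>i\<in>{1..n}. (filter_bias n h f i)\<^sup>2)
      \<le> real N * (2 * s + 1) + real n * (2 * \<beta> * h)\<^sup>2"
    using sum_filter_bias_square_le[OF f, of "2 * \<beta>" h n] \<open>\<beta> > 0\<close> h'(2) unfolding h'(4) by simp
  have "real N * (2 * s + 1) \<le> 3 * real N * s"
    using mult_left_mono[of "2 * s + 1" "3 * s" "real N"] s by (simp add: mult_ac)
  moreover have "real n * (2 * \<beta> * h)\<^sup>2 = (2 * \<beta>)\<^sup>2"
    using s by (simp add: h'(1) power2_eq_square)
  moreover have "(2 * \<beta>)\<^sup>2 * 1 \<le> (2 * \<beta>)\<^sup>2 * s" using s by (intro mult_left_mono) auto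
  ultimately have "(\<Sum>i\<in>{1..n}. (filter_bias n h f i)\<^sup>2) \<le> (3 * real N + (2 * \<beta>)\<^sup>2) * s"
    using sq_bias by (simp add: distrib_right)
  with var have "(\<Sum>i\<in>{1..n}. (filter_bias n h f i)\<^sup>2 + v / real (card (window n h i)))
      \<le> (3 * real N + (2 * \<beta>)\<^sup>2 + 2 * v) * s"
    by (simp add: sum.distrib algebra_simps)
  then have "(\<Sum>i\<in>{1..n}. (filter_bias n h f i)\<^sup>2 + v / real (card (window n h i))) / (s * s)
      \<le> (3 * real N + (2 * \<beta>)\<^sup>2 + 2 * v) * s / (s * s)"
    using s by (intro divide_right_mono) auto
  then show ?thesis using s by (simp add: s_def[symmetric])
qed

section \<open>The lower bound\<close>

definition half_step :: "real \<Rightarrow> real" where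
  "half_step x = (if x > 1 / 2 then 1 else 0)"

text \<open>Away from the jump the step is locally constant, so all difference quotients vanish eventually.
  The jump point may be listed repeatedly, which is why one jump is enough for every \<open>N\<close>.\<close>

lemma half_step_in_PLIP:
  assumes "N \<ge> 1" and "\<beta> \<ge> 0"
  shows "half_step \<in> PLIP \<beta> N"
proof -
  have "local_lip half_step t \<le> ereal \<beta>" if "t \<noteq> 1 / 2" for t
    unfolding local_lip_def
  proof (rule Limsup_bounded)
    have "eventually (\<lambda>\<epsilon>. \<epsilon> < \<bar>t - 1 / 2\<bar>) (at_right (0::real))"
      using that by (intro eventually_at_rightI[of 0 "\<bar>t - 1 / 2\<bar>"]) auto
    then show "eventually (\<lambda>\<epsilon>. (SUP y\<in>{y \<in> {0..1}. \<bar>y - t\<bar> \<le> \<epsilon> \<and> y \<noteq> t}.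
        ereal (\<bar>half_step y - half_step t\<bar> / \<bar>y - t\<bar>)) \<le> ereal \<beta>) (at_right 0)"
    proof eventually_elim
      case (elim \<epsilon>)
      have "half_step y = half_step t" if "\<bar>y - t\<bar> \<le> \<epsilon>" for y
        using elim that by (auto simp: half_step_def)
      then show ?case using \<open>\<beta> \<ge> 0\<close> by (intro SUP_least) auto
    qed
  qed
  moreover have "(\<lambda>_. 1 / 2 :: real) ` {1..N} = {1 / 2}" using \<open>N \<ge> 1\<close> by auto
  ultimately show ?thesis
    by (auto simp: PLIP_def half_step_def[abs_def] intro!: exI[of _ "\<lambda>_. 1 / 2"])
qed

text \<open>The number \<open>q\<close> is half of the bandwidth, counted in grid points. For a grid point among the last \<open>q\<close> on the left of the step, the first
  \<open>q\<close> points on the right all lie in its window and contribute one each, while the window has at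
  most \<open>4 q + 3 \<le> 7 q\<close> points. Capping the bandwidth at \<open>n\<close> keeps all these points on the grid, so
  arbitrarily large bandwidths are covered as well.\<close>

lemma filter_bias_half_step_ge:
  assumes "h \<ge> 0" and k: "k = min (nat \<lfloor>real n * h\<rfloor>) n" and q: "q = k div 2"
    and i: "i \<in> {n div 2 - q<..n div 2}"
  shows "filter_bias n h half_step i \<ge> 1 / 7"
proof -
  let ?W = "window n h i" and ?p = "n div 2"
  let ?m = "real (card ?W)"
  have qn: "2 * q \<le> nat \<lfloor>real n * h\<rfloor>" "2 * q \<le> n" "0 < q" using k q i unfolding greaterThanAtMost_iff by linarith+
  have i': "i \<in> {1..n}" using i by auto
  have n: "real n > 0" using i' by simp
  have m: "?m > 0" using card_window_pos[OF \<open>h \<ge> 0\<close> i'] by simp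
  have "card ?W \<le> 2 * k + 1" using card_window_le[OF \<open>h \<ge> 0\<close>] k by simp
  then have "card ?W \<le> 7 * q" using q qn by simp
  then have mq: "?m \<le> 7 * real q" by linarith
  have "{?p<..?p + q} \<subseteq> ?W"
    unfolding window_eq_nat[OF \<open>h \<ge> 0\<close>] using i qn by auto
  moreover have "half_step (real j / real n) = 1" if "j \<in> {?p<..?p + q}" for j
  proof -
    have "n < 2 * j" using that by auto
    then have "real n < 2 * real j" by linarith
    then show ?thesis using n by (simp add: half_step_def field_simps)
  qed
  ultimately have "(\<Sum>j\<in>{?p<..?p + q}. 1) \<le> (\<Sum>j\<in>?W. half_step (real j / real n))"
    by (intro order.trans[OF _ sum_mono2[of ?W "{?p<..?p + q}"]] sum_mono)
      (auto simp: half_step_def)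
  then have "real q / ?m \<le> linear_filter n h (\<lambda>j. half_step (real j / real n)) i"
    unfolding linear_filter_def using m by (intro divide_right_mono) auto
  moreover have "half_step (real i / real n) = 0"
  proof -
    have "2 * i \<le> n" using i by auto
    then have "2 * real i \<le> real n" by linarith
    then show ?thesis using n by (simp add: half_step_def field_simps)
  qed
  moreover have "1 / 7 \<le> real q / ?m" using mq m by (simp add: field_simps)
  ultimately show ?thesis unfolding filter_bias_def by linarith
qed

text \<open>With \<open>q\<close> again half of the bandwidth, the bias contributes at least \<open>q/49\<close> to the sum and, for
  \<open>q \<ge> 1\<close>, the variance contributes at least \<open>n v / (7 q)\<close>; the product
  of the two does not depend on the bandwidth. If \<open>q = 0\<close>, windows have at most three points and
  the variance alone stays bounded away from zero.\<close>

lemma mse_half_step_ge: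
  assumes "h \<ge> 0" and "v > 0" and "n \<ge> 1"
  shows "min (v / 3) (2 * sqrt v / 49) / sqrt (real n)
    \<le> (\<Sum>i\<in>{1..n}. (filter_bias n h half_step i)\<^sup>2 + v / real (card (window n h i))) / real n"
proof -
  define k where "k = min (nat \<lfloor>real n * h\<rfloor>) n"
  define q where "q = k div 2"
  define s where "s = sqrt (real n)"
  have s: "s \<ge> 1" "real n = s * s" using \<open>n \<ge> 1\<close> by (auto simp: s_def)
  have var: "real n * (v / real (4 * q + 3)) \<le> (\<Sum>i\<in>{1..n}. v / real (card (window n h i)))"
  proof -
    have "v / real (4 * q + 3) \<le> v / real (card (window n h i))" if i: "i \<in> {1..n}" for i
    proof (intro divide_left_mono)
      have "card (window n h i) \<le> 2 * k + 1" using card_window_le[OF \<open>h \<ge> 0\<close>] k_def by simp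
      then show "real (card (window n h i)) \<le> real (4 * q + 3)" unfolding q_def by linarith
    qed (use \<open>v > 0\<close> card_window_pos[OF \<open>h \<ge> 0\<close> i] in auto)
    then have "(\<Sum>i\<in>{1..n}. v / real (4 * q + 3)) \<le> (\<Sum>i\<in>{1..n}. v / real (card (window n h i)))"
      by (intro sum_mono)
    then show ?thesis by simp
  qed
  have bias: "real q / 49 \<le> (\<Sum>i\<in>{1..n}. (filter_bias n h half_step i)\<^sup>2)"
  proof -
    let ?J = "{n div 2 - q<..n div 2}"
    have "k \<le> n" by (simp add: k_def)
    then have "card ?J = q" by (auto simp: q_def)
    then have "real q / 49 = (\<Sum>i\<in>?J. (1 / 7)\<^sup>2)" by (simp add: power2_eq_square)
    also have "\<dots> \<le> (\<Sum>i\<in>?J. (filter_bias n h half_step i)\<^sup>2)"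
      using filter_bias_half_step_ge[OF \<open>h \<ge> 0\<close> k_def q_def] by (intro sum_mono power_mono) auto
    also have "\<dots> \<le> (\<Sum>i\<in>{1..n}. (filter_bias n h half_step i)\<^sup>2)"
      by (intro sum_mono2) auto
    finally show ?thesis .
  qed
  have "min (v / 3) (2 * sqrt v / 49) * s \<le> real q / 49 + real n * (v / real (4 * q + 3))"
  proof (cases "q = 0")
    case True
    have "min (v / 3) (2 * sqrt v / 49) * s \<le> v / 3 * s" using s by (intro mult_right_mono) auto
    also have "\<dots> \<le> v / 3 * real n" using s \<open>v > 0\<close> by simp
    finally show ?thesis using True by (simp add: mult.commute)
  next
    case False
    \<comment> \<open>Weakening \<open>1/(4 q + 3)\<close> to \<open>1/(49 q)\<close> makes both terms squares up to the common factor
      \<open>1/49\<close>, in the shape needed for the arithmetic-geometric mean inequality.\<close>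
    define r where "r = sqrt (real q)"
    have r: "r > 0" "r\<^sup>2 = real q" using False by (auto simp: r_def)
    have sv: "(s * sqrt v)\<^sup>2 = real n * v" using \<open>v > 0\<close> s by (simp add: power_mult_distrib power2_eq_square)
    have "min (v / 3) (2 * sqrt v / 49) * s \<le> 2 * sqrt v / 49 * s"
      using s by (intro mult_right_mono) auto
    also have "\<dots> = (2 * r * (s * sqrt v / r)) / 49" using r by simp
    also have "\<dots> \<le> (r\<^sup>2 + (s * sqrt v / r)\<^sup>2) / 49"
      by (intro divide_right_mono sum_squares_bound) simp
    also have "\<dots> = real q / 49 + real n * (v / (49 * real q))"
      using False by (simp add: power_divide r sv add_divide_distrib)
    also have "\<dots> \<le> real q / 49 + real n * (v / real (4 * q + 3))"
      using False \<open>v > 0\<close> by (intro add_left_mono mult_left_mono divide_left_mono) auto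
    finally show ?thesis .
  qed
  then have "min (v / 3) (2 * sqrt v / 49) * s
      \<le> (\<Sum>i\<in>{1..n}. (filter_bias n h half_step i)\<^sup>2 + v / real (card (window n h i)))"
    using var bias by (simp add: sum.distrib)
  then have "min (v / 3) (2 * sqrt v / 49) * s / (s * s)
      \<le> (\<Sum>i\<in>{1..n}. (filter_bias n h half_step i)\<^sup>2 + v / real (card (window n h i))) / (s * s)"
    using s by (intro divide_right_mono) auto
  then show ?thesis using s by (simp add: s_def[symmetric])
qed

section \<open>The rate\<close>

theorem theorem2p1:
  fixes \<sigma> \<beta> :: real and N :: nat
    and \<Psi> :: "real measure"
    and M :: "nat \<Rightarrow> 'a measure"
    and Z :: "nat \<Rightarrow> nat \<Rightarrow> 'a \<Rightarrow> real"
  assumes "\<sigma> > 0" and "N \<ge> 1" and "\<beta> > 0"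
    and "real_distribution \<Psi>"
    and "integrable \<Psi> (\<lambda>x. x)" and "prob_space.expectation \<Psi> (\<lambda>x. x) = 0"
    and "integrable \<Psi> (\<lambda>x. x\<^sup>2)" and "prob_space.variance \<Psi> (\<lambda>x. x) \<noteq> 0"
    and "\<And>n. n \<ge> 1 \<Longrightarrow> white_noise (M n) \<Psi> n (Z n)"
  shows "(\<lambda>n. INF h\<in>{0<..}. worst_risk (M n) \<sigma> n (Z n) (linear_filter n h) (PLIP \<beta> N))
           \<in> \<Theta>(\<lambda>n. real n powr (-1/2))"
proof -
  define v where "v = \<sigma>\<^sup>2 * (\<integral>x. x\<^sup>2 \<partial>\<Psi>)"
  have "(\<integral>x. x\<^sup>2 \<partial>\<Psi>) \<noteq> 0" using assms(6,8) by simp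
  moreover have "(\<integral>x. x\<^sup>2 \<partial>\<Psi>) \<ge> 0" by simp
  ultimately have v: "v > 0" using \<open>\<sigma> > 0\<close> unfolding v_def by (intro mult_pos_pos zero_less_power) linarith+
  define mse where "mse n h f =
    (\<Sum>i\<in>{1..n}. (filter_bias n h f i)\<^sup>2 + v / real (card (window n h i))) / real n" for n h f
  have risk: "risk (M n) \<sigma> n (Z n) (linear_filter n h) f = mse n h f" if "n \<ge> 1" "h > 0" for n h f
    using risk_linear_filter[OF assms(9)[OF \<open>n \<ge> 1\<close>] assms(5-7)] that by (simp add: mse_def v_def)
  have mse_bounded: "mse n h f \<le> 1 + v" if "n \<ge> 1" "h > 0" "f \<in> PLIP \<beta> N" for n h f
  proof -
    have "(filter_bias n h f i)\<^sup>2 + v / real (card (window n h i)) \<le> 1 + v" if i: "i \<in> {1..n}" for i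
    proof (intro add_mono)
      show "(filter_bias n h f i)\<^sup>2 \<le> 1"
        using abs_filter_bias_PLIP_le_1[OF \<open>f \<in> PLIP \<beta> N\<close> _ i] \<open>h > 0\<close>
        by (simp add: abs_square_le_1)
      have "1 \<le> card (window n h i)" using card_window_pos[OF _ i, of h] \<open>h > 0\<close> by linarith
      then show "v / real (card (window n h i)) \<le> v"
        using v divide_left_mono[of 1 "real (card (window n h i))" v] by simp
    qed
    then have "(\<Sum>i\<in>{1..n}. (filter_bias n h f i)\<^sup>2 + v / real (card (window n h i)))
        \<le> (\<Sum>i\<in>{1..n}. 1 + v)"
      by (rule sum_mono)
    then show ?thesis using \<open>n \<ge> 1\<close> by (simp add: mse_def field_simps)
  qed
  \<comment> \<open>The uniform bound on the risks matters for the lower bound: only for a bounded set is a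
    real supremum sure to dominate the members.\<close>
  define worst where "worst n h = worst_risk (M n) \<sigma> n (Z n) (linear_filter n h) (PLIP \<beta> N)" for n h
  have worst: "worst n h = (SUP f\<in>PLIP \<beta> N. mse n h f)" if "n \<ge> 1" "h > 0" for n h
    using risk[OF that] by (simp add: worst_def worst_risk_def)
  have step: "half_step \<in> PLIP \<beta> N" using half_step_in_PLIP \<open>N \<ge> 1\<close> \<open>\<beta> > 0\<close> by simp
  define c where "c = min (v / 3) (2 * sqrt v / 49)"
  define C where "C = 3 * real N + (2 * \<beta>)\<^sup>2 + 2 * v"
  have c: "c > 0" using v by (simp add: c_def)
  have C: "C > 0" unfolding C_def using v by (intro add_nonneg_pos) auto
  have lower: "c / sqrt (real n) \<le> worst n h" if "n \<ge> 1" "h > 0" for n h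
  proof -
    have "bdd_above (mse n h ` PLIP \<beta> N)" using mse_bounded[OF that] by (intro bdd_aboveI2)
    then have "mse n h half_step \<le> worst n h"
      unfolding worst[OF that] using step by (rule cSUP_upper[rotated])
    then show ?thesis
      using mse_half_step_ge[of h v n] v that unfolding mse_def c_def by simp
  qed
  have upper: "worst n (1 / sqrt (real n)) \<le> C / sqrt (real n)" if "n \<ge> 1" for n
  proof -
    have "1 / sqrt (real n) > 0" using that by simp
    then show ?thesis
      unfolding worst[OF that \<open>1 / sqrt (real n) > 0\<close>] mse_def C_def
      using step mse_bound_root_bandwidth[OF _ \<open>\<beta> > 0\<close> _ that refl] v by (intro cSUP_least) auto
  qed
  have INF: "c * real n powr (-1/2) \<le> (INF h\<in>{0<..}. worst n h)"
    "(INF h\<in>{0<..}. worst n h) \<le> C * real n powr (-1/2)" if "n \<ge> 1" for n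
  proof -
    have pow: "real n powr (-1/2) = 1 / sqrt (real n)"
      using powr_minus_divide[of "real n" "1/2"] by (simp add: powr_half_sqrt)
    show "c * real n powr (-1/2) \<le> (INF h\<in>{0<..}. worst n h)"
      unfolding pow using lower[OF that] by (intro cINF_greatest) auto
    have "bdd_below (worst n ` {0<..})" using lower[OF that] by (intro bdd_belowI2) auto
    then have "(INF h\<in>{0<..}. worst n h) \<le> worst n (1 / sqrt (real n))"
      using that by (intro cINF_lower) auto
    then show "(INF h\<in>{0<..}. worst n h) \<le> C * real n powr (-1/2)"
      unfolding pow using upper[OF that] by simp
  qed
  have nonneg: "0 \<le> (INF h\<in>{0<..}. worst n h)" if "n \<ge> 1" for n
    using INF(1)[OF that] c by (meson mult_nonneg_nonneg less_imp_le order_trans powr_ge_zero)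
  have "(\<lambda>n. INF h\<in>{0<..}. worst n h) \<in> \<Theta>(\<lambda>n. real n powr (-1/2))"
  proof (rule bigthetaI')
    show "eventually (\<lambda>n. c * norm (real n powr (-1/2)) \<le> norm (INF h\<in>{0<..}. worst n h)
        \<and> norm (INF h\<in>{0<..}. worst n h) \<le> C * norm (real n powr (-1/2))) sequentially"
      using eventually_ge_at_top[of 1]
    proof eventually_elim
      case (elim n)
      then show ?case using INF[OF elim] nonneg[OF elim] by simp
    qed
  qed (use c C in auto)
  then show ?thesis by (simp add: worst_def)
qed

end
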